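(* Let $\tilde\eta\in\mathbb{K}[[t]]^*$ and $\tilde\xi\in\mathbb{K}[[u]]^*$ be dual of each other and let $m,n\in\mathbb{N}^*$. Let $\tilde a$ be the constant term of $\tilde\eta$. Put $$\eta(t)=(t\,\tilde\eta(t))^m,\qquad \xi(u)=(u\,\tilde\xi(u))^n,$$ and denote $$\mathrm{ess}(\eta,n)=(m,\epsilon_1,\dots,\epsilon_d),\qquad \mathrm{ess}(\xi,m)=(n,\epsilon'_1,\dots,\epsilon'_{d'}).$$ Then: (1) $d'=d$; (2) $\epsilon'_k+m=\epsilon_k+n$ for all $k\in\{1,\dots,d\}$; (3) $[\xi]_n=\tilde a^{-n}$ and $[\xi]_{\epsilon'_k}=-\dfrac{n}{m}\,\tilde a^{-n-\epsilon_k}\,[\eta]_{\epsilon_k}$ for all $k\in\{1,\dots,d\}$.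
   Context: $\mathbb{K}$ is an algebraically closed field of characteristic zero; $\mathbb{N}^*$ is the set of positive integers. $\mathbb{K}[[t]]^*$ is the set of formal power series with non-zero constant term. For a series $\phi$, $[\phi]_r$ is the coefficient of the monomial of exponent $r$, and the support $\mathcal{S}(\phi)$ is the set of exponents with non-zero coefficient. Dual: if $\phi\in\mathbb{K}[[t]]^*$, its dual is the unique series $\check{\phi}\in\mathbb{K}[[u]]^*$ such that $u\,\check{\phi}(u)$ and $t\,\phi(t)$ are reciprocal, i.e. inverse of each other for composition. A set with bounded denominators in $\mathbb{Q}_+$ is a non-empty set $E$ contained in $\frac1n\mathbb{N}$ for some positive integer $n$. For such $E$ and $p\in\mathbb{N}^*$, the sequence of essential elements $\mathrm{ess}(E,p)=(e_0,e_1,\dots)$ of $E$ relative to $p$ is defined inductively: $e_0=\min E$; for $l\ge1$, $e_l$ is defined if and only if $E\not\subset\mathbb{Z}\{p,e_0,\dots,e_{l-1}\}$ (the subgroup generated), and then $e_l=\min(E\setminus\mathbb{Z}\{p,e_0,\dots,e_{l-1}\})$. For a non-zero series $\phi$, $\mathrm{ess}(\phi,p):=\mathrm{ess}(\mathcal{S}(\phi),p)$. *)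

theory Defs
  imports "HOL-Computational_Algebra.Computational_Algebra"
begin

text \<open>A series and its dual are related symmetrically: both have non-zero constant term, and
  \<open>t \<phi>(t)\<close> and \<open>u \<psi>(u)\<close> are inverse to each other for composition.\<close>

definition dual_fps :: "'a::field fps \<Rightarrow> 'a fps \<Rightarrow> bool" where
  "dual_fps \<phi> \<psi> \<longleftrightarrow>
     fps_nth \<phi> 0 \<noteq> 0 \<and> fps_nth \<psi> 0 \<noteq> 0 \<and>
     fps_compose (fps_X * \<phi>) (fps_X * \<psi>) = fps_X \<and>
     fps_compose (fps_X * \<psi>) (fps_X * \<phi>) = fps_X"

definition bounded_denominators :: "rat set \<Rightarrow> bool" where
  "bounded_denominators E \<longleftrightarrow>
     E \<noteq> {} \<and> (\<exists>N::nat. N > 0 \<and> E \<subseteq> (\<lambda>k::nat. of_nat k / of_nat N) ` UNIV)"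

text \<open>The entry with index \<open>l\<close> of the sequence of essential elements is \<open>None\<close> when \<open>e\<^sub>l\<close> is not
  defined. The definition is meant for sets with bounded denominators; their non-empty subsets
  have a minimum, which is what \<open>LEAST\<close> denotes (see \<open>bounded_denominators_Least\<close>).\<close>

fun ess :: "rat set \<Rightarrow> nat \<Rightarrow> nat \<Rightarrow> rat option" where
  "ess E p 0 = Some (LEAST e. e \<in> E)"
| "ess E p (Suc l) =
     (let H = group_closure (insert (of_nat p) (\<Union>j\<in>{..l}. set_option (ess E p j)))
      in if E \<subseteq> H then None else Some (LEAST e. e \<in> E - H))"

definition fps_supp :: "'a::zero fps \<Rightarrow> rat set" where
  "fps_supp \<phi> = {of_nat r | r. fps_nth \<phi> r \<noteq> 0}"

definition ess_fps :: "'a::zero fps \<Rightarrow> nat \<Rightarrow> nat \<Rightarrow> rat option" where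
  "ess_fps \<phi> p = ess (fps_supp \<phi>) p"

text \<open>The finite sequence \<open>(e\<^sub>0, \<dots>, e\<^sub>d)\<close>.\<close>

definition finite_seq :: "nat \<Rightarrow> (nat \<Rightarrow> rat) \<Rightarrow> nat \<Rightarrow> rat option" where
  "finite_seq d e = (\<lambda>l. if l \<le> d then Some (e l) else None)"

lemma bounded_denominators_Least:
  assumes "bounded_denominators E" "F \<subseteq> E" "F \<noteq> {}"
  shows "(LEAST e. e \<in> F) \<in> F" "\<forall>x\<in>F. (LEAST e. e \<in> F) \<le> x"
proof -
  obtain N :: nat where N: "N > 0" "E \<subseteq> (\<lambda>k::nat. of_nat k / of_nat N) ` UNIV"
    using assms(1) by (auto simp: bounded_denominators_def)
  define P where "P = (\<lambda>k::nat. (of_nat k / of_nat N :: rat) \<in> F)"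
  have ex: "\<exists>k. P k" using assms N unfolding P_def by blast
  define k where "k = (LEAST k. P k)"
  have k: "P k" "\<And>j. P j \<Longrightarrow> k \<le> j"
    using ex unfolding k_def by (auto intro: LeastI_ex Least_le)
  have min: "of_nat k / of_nat N \<le> x" if x: "x \<in> F" for x
  proof -
    obtain j :: nat where j: "x = of_nat j / of_nat N" using x assms(2) N by blast
    with x have "k \<le> j" by (intro k(2)) (simp add: P_def)
    with j N show ?thesis by (simp add: divide_right_mono)
  qed
  have "(LEAST e. e \<in> F) = of_nat k / of_nat N"
    using k(1) min unfolding P_def by (intro Least_equality) auto
  with k(1) min show "(LEAST e. e \<in> F) \<in> F" "\<forall>x\<in>F. (LEAST e. e \<in> F) \<le> x"
    unfolding P_def by auto
qed

lemma bounded_denominators_fps_supp: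
  fixes \<phi> :: "'a::zero fps"
  assumes "\<phi> \<noteq> 0"
  shows "bounded_denominators (fps_supp \<phi>)"
proof -
  have "fps_supp \<phi> \<noteq> {}"
    using assms by (auto simp: fps_supp_def fps_eq_iff)
  moreover have "fps_supp \<phi> \<subseteq> (\<lambda>k::nat. of_nat k / of_nat 1) ` UNIV"
    by (auto simp: fps_supp_def)
  ultimately show ?thesis
    unfolding bounded_denominators_def by (intro conjI exI[of _ 1]) auto
qed

lemma ess_in:
  assumes "bounded_denominators E" "ess E p l = Some e"
  shows "e \<in> E"
proof (cases l)
  case 0
  with assms show ?thesis
    using bounded_denominators_Least(1)[OF assms(1), of E]
    by (auto simp: bounded_denominators_def)
next
  case (Suc k)
  define H where
    "H = group_closure (insert (of_nat p) (\<Union>j\<in>{..k}. set_option (ess E p j)))"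
  have "\<not> E \<subseteq> H" "e = (LEAST e. e \<in> E - H)"
    using assms(2) Suc by (auto simp: H_def Let_def split: if_splits)
  then show ?thesis
    using bounded_denominators_Least(1)[OF assms(1), of "E - H"] by auto
qed

lemma ess_None_mono:
  assumes "ess E p l = None" "l \<le> l'"
  shows "ess E p l' = None"
  using assms(2,1)
proof (induction l' rule: dec_induct)
  case (step k)
  then have k: "ess E p k = None" by simp
  then obtain i where i: "k = Suc i" by (cases k) auto
  then have "{..k} = insert k {..i}" by auto
  with k i show ?case by (auto simp: Let_def split: if_splits)
qed

text \<open>\<open>ess(E, p) = (e\<^sub>0, \<dots>, e\<^sub>d)\<close> for some \<open>d\<close>: the \<open>e\<^sub>l\<close> are pairwise incongruent modulo \<open>p\<close>.\<close>

lemma ess_finite: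
  assumes E: "bounded_denominators E" and p: "p > 0"
  shows "\<exists>d e. ess E p = finite_seq d e"
proof -
  obtain N :: nat where N: "N > 0" "E \<subseteq> (\<lambda>k::nat. of_nat k / of_nat N) ` UNIV"
    using E by (auto simp: bounded_denominators_def)
  have "\<exists>l. ess E p l = None"
  proof (rule ccontr)
    assume "\<not> ?thesis"
    then have ex: "\<exists>e. ess E p l = Some e" for l by auto
    have "\<forall>l. \<exists>k::nat. ess E p l = Some (of_nat k / of_nat N)"
    proof
      fix l
      obtain e where e: "ess E p l = Some e" using ex by blast
      then have "e \<in> (\<lambda>k::nat. of_nat k / of_nat N) ` UNIV"
        using ess_in[OF E] N(2) by blast
      with e show "\<exists>k::nat. ess E p l = Some (of_nat k / of_nat N)" by auto
    qed
    then obtain k where k: "\<And>l. ess E p l = Some (of_nat (k l :: nat) / of_nat N)"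
      using choice[of "\<lambda>l k. ess E p l = Some (of_nat k / of_nat N)"] by blast
    have neq: "k i mod (p * N) \<noteq> k l mod (p * N)" if il: "i < l" for i l
    proof
      assume eq: "k i mod (p * N) = k l mod (p * N)"
      obtain j where j: "l = Suc j" "i \<le> j" using il by (cases l) auto
      define H where
        "H = group_closure (insert (of_nat p) (\<Union>j'\<in>{..j}. set_option (ess E p j')))"
      let ?x = "of_nat (k l) / of_nat N :: rat"
      let ?y = "of_nat (k i) / of_nat N :: rat"
      have "\<not> E \<subseteq> H" "?x = (LEAST e. e \<in> E - H)"
        using k[of l] j by (auto simp: H_def Let_def split: if_splits)
      then have nin: "?x \<notin> H"
        using bounded_denominators_Least(1)[OF E, of "E - H"] by auto
      have pH: "of_nat p \<in> H" unfolding H_def by (rule group_closure.base) simp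
      have yH: "?y \<in> H" unfolding H_def
      proof (rule group_closure.base)
        have "?y \<in> set_option (ess E p i)" using k[of i] by simp
        with j(2) show "?y \<in> insert 0 (insert (of_nat p)
            (\<Union>j'\<in>{..j}. set_option (ess E p j')))"
          by blast
      qed
      have mult: "of_nat c * of_nat p \<in> H" for c :: nat
        using pH unfolding H_def by (rule group_closure_scalar_mult_left)
      define a b where "a = k i div (p * N)" and "b = k l div (p * N)"
      have "k l + a * (p * N) = k i + b * (p * N)"
        unfolding a_def b_def
        using div_mult_mod_eq[of "k l" "p * N"] div_mult_mod_eq[of "k i" "p * N"] eq
        by linarith
      then have "(of_nat (k l + a * (p * N)) :: rat) = of_nat (k i + b * (p * N))"
        by (rule arg_cong)
      then have "?x = ?y + of_nat b * of_nat p - of_nat a * of_nat p"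
        using N(1) by (simp add: field_simps)
      moreover have "?y + of_nat b * of_nat p - of_nat a * of_nat p \<in> H"
        using yH mult unfolding H_def
        by (intro group_closure.diff group_closure_add) auto
      ultimately show False using nin by simp
    qed
    have "inj (\<lambda>l. k l mod (p * N))"
      by (rule linorder_injI) (use neq in blast)
    moreover have "range (\<lambda>l. k l mod (p * N)) \<subseteq> {..<p * N}"
      using p N by auto
    ultimately have "finite (UNIV :: nat set)"
      by (metis finite_imageD finite_lessThan finite_subset)
    then show False by simp
  qed
  define L where "L = (LEAST l. ess E p l = None)"
  have L: "ess E p L = None" "\<And>l. l < L \<Longrightarrow> ess E p l \<noteq> None"
    using \<open>\<exists>l. ess E p l = None\<close> unfolding L_def by (auto intro: LeastI_ex dest: not_less_Least)
  then obtain d where d: "L = Suc d" by (cases L) auto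
  have "ess E p = finite_seq d (\<lambda>l. the (ess E p l))"
  proof
    fix l
    show "ess E p l = finite_seq d (\<lambda>l. the (ess E p l)) l"
      using L(2)[of l] ess_None_mono[OF L(1), of l] d
      by (auto simp: finite_seq_def)
  qed
  then show ?thesis by blast
qed

lemma ess_fps_finite:
  fixes \<phi> :: "'a::zero fps"
  assumes "\<phi> \<noteq> 0" "p > 0"
  shows "\<exists>d (e :: nat \<Rightarrow> nat). ess_fps \<phi> p = finite_seq d (\<lambda>l. of_nat (e l))"
proof -
  note bd = bounded_denominators_fps_supp[OF assms(1)]
  obtain d e where de: "ess_fps \<phi> p = finite_seq d e"
    using ess_finite[OF bd assms(2)] unfolding ess_fps_def by blast
  have "\<exists>r::nat. e l = of_nat r" if "l \<le> d" for l
  proof -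
    have "ess (fps_supp \<phi>) p l = Some (e l)"
      using de that by (simp add: ess_fps_def finite_seq_def fun_eq_iff)
    from ess_in[OF bd this] show ?thesis by (auto simp: fps_supp_def)
  qed
  then obtain r :: "nat \<Rightarrow> nat" where "\<And>l. l \<le> d \<Longrightarrow> e l = of_nat (r l)" by metis
  then have "finite_seq d e = finite_seq d (\<lambda>l. of_nat (r l))"
    by (auto simp: finite_seq_def)
  with de show ?thesis by auto
qed

end

theory Submission
  imports Defs
begin

text \<open>Let \<open>K\<close> be an additive submonoid of the natural numbers and suppose that below degree \<open>J \<notin> K\<close>
  the series \<open>\<phi>\<close> has exponents in \<open>K\<close> only. Then \<open>J\<close> is not a sum of two exponents of \<open>K\<close>, so the
  coefficient of degree \<open>J\<close> of a power \<open>\<phi>\<^sup>k\<close> is the linear term \<open>k \<phi>\<^sub>0\<^bsup>k-1\<^esup> \<phi>\<^sub>J\<close>; likewise, the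
  coefficient of degree \<open>J\<close> in the equation defining the dual of \<open>\<phi>\<close> is linear in \<open>\<phi>\<^sub>J\<close>. Hence the
  first exponent outside \<open>K\<close> is the same for \<open>\<phi>\<close>, for its powers, for its dual and for the powers
  of the dual. The groups generated by \<open>m\<close>, \<open>n\<close> and the first essential exponents agree on both
  sides, and applying this to their natural elements gives one essential exponent after the other.\<close>

section \<open>First exponents outside a monoid, for products and powers\<close>

definition supp_below :: "nat set \<Rightarrow> nat \<Rightarrow> 'a::zero fps \<Rightarrow> bool" where
  "supp_below K J \<phi> \<longleftrightarrow> (\<forall>j<J. j \<notin> K \<longrightarrow> fps_nth \<phi> j = 0)"

lemma supp_belowD: "supp_below K J \<phi> \<Longrightarrow> j < J \<Longrightarrow> j \<notin> K \<Longrightarrow> fps_nth \<phi> j = 0"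
  by (simp add: supp_below_def)

lemma supp_below_mono: "supp_below K J \<phi> \<Longrightarrow> I \<le> J \<Longrightarrow> supp_below K I \<phi>"
  by (simp add: supp_below_def)

text \<open>Strong induction on the degree. A formula for the first coefficient outside
  \<open>K\<close> thereby shows that all coefficients outside \<open>K\<close> below
  \<open>J\<close> vanish.\<close>

lemma supp_below_induct:
  assumes "\<And>j. j < J \<Longrightarrow> j \<notin> K \<Longrightarrow> supp_below K j \<phi> \<Longrightarrow> fps_nth \<phi> j = 0"
  shows "supp_below K J \<phi>"
proof -
  have "j < J \<Longrightarrow> j \<notin> K \<Longrightarrow> fps_nth \<phi> j = 0" for j
  proof (induction j rule: less_induct)
    case (less j)
    then have "supp_below K j \<phi>" by (simp add: supp_below_def)
    with less.prems assms show ?case by blast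
  qed
  then show ?thesis by (simp add: supp_below_def)
qed

lemma fps_nth_power_X_mult:
  fixes \<phi> :: "'a::comm_ring_1 fps"
  shows "fps_nth ((fps_X * \<phi>) ^ k) r = (if r < k then 0 else fps_nth (\<phi> ^ k) (r - k))"
  by (simp add: power_mult_distrib fps_X_power_mult_nth)

locale nat_submonoid =
  fixes K :: "nat set"
  assumes zero_closed: "0 \<in> K"
    and add_closed: "i \<in> K \<Longrightarrow> j \<in> K \<Longrightarrow> i + j \<in> K"
begin

text \<open>If \<open>J = i + (J - i)\<close> with both parts positive, closure of \<open>K\<close>
  under addition forces one part outside \<open>K\<close>. That part is below \<open>J\<close>, so
  its coefficient vanishes and only the two extreme terms of the Cauchy product survive.\<close>

lemma fps_mult_nth_notin:
  fixes \<phi> \<psi> :: "'a::comm_ring_1 fps"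
  assumes \<phi>: "supp_below K J \<phi>" and \<psi>: "supp_below K J \<psi>" and J: "J \<notin> K"
  shows "fps_nth (\<phi> * \<psi>) J = fps_nth \<phi> 0 * fps_nth \<psi> J + fps_nth \<phi> J * fps_nth \<psi> 0"
proof -
  have J0: "J \<noteq> 0" using J zero_closed by metis
  have z: "fps_nth \<phi> i * fps_nth \<psi> (J - i) = 0" if "i \<in> {0..J} - {0, J}" for i
  proof -
    from that have i: "0 < i" "i < J" by auto
    then have "i \<notin> K \<or> J - i \<notin> K"
      using add_closed[of i "J - i"] J by auto
    with i supp_belowD[OF \<phi>, of i] supp_belowD[OF \<psi>, of "J - i"] show ?thesis by auto
  qed
  have "fps_nth (\<phi> * \<psi>) J = (\<Sum>i=0..J. fps_nth \<phi> i * fps_nth \<psi> (J - i))"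
    by (rule fps_mult_nth)
  also have "\<dots> = (\<Sum>i\<in>{0, J}. fps_nth \<phi> i * fps_nth \<psi> (J - i))"
    using z by (intro sum.mono_neutral_right) auto
  finally show ?thesis using J0 by simp
qed

lemma supp_below_mult:
  fixes \<phi> \<psi> :: "'a::comm_ring_1 fps"
  assumes "supp_below K J \<phi>" "supp_below K J \<psi>"
  shows "supp_below K J (\<phi> * \<psi>)"
  unfolding supp_below_def
proof (intro allI impI)
  fix j assume j: "j < J" "j \<notin> K"
  then have "supp_below K j \<phi>" "supp_below K j \<psi>"
    using assms by (auto intro: supp_below_mono)
  from fps_mult_nth_notin[OF this j(2)] j assms
  show "fps_nth (\<phi> * \<psi>) j = 0" by (simp add: supp_belowD)
qed

lemma supp_below_power:
  fixes \<phi> :: "'a::comm_ring_1 fps"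
  assumes "supp_below K J \<phi>"
  shows "supp_below K J (\<phi> ^ k)"
proof (induction k)
  case 0
  show ?case using zero_closed by (auto simp: supp_below_def)
next
  case (Suc k)
  with assms show ?case by (simp add: supp_below_mult)
qed

text \<open>By the product formula the coefficient of degree \<open>J\<close> obeys the Leibniz
  rule, so a power is treated as under a derivation.\<close>

lemma fps_power_nth_notin:
  fixes \<phi> :: "'a::comm_ring_1 fps"
  assumes \<phi>: "supp_below K J \<phi>" and J: "J \<notin> K"
  shows "fps_nth (\<phi> ^ k) J = of_nat k * fps_nth \<phi> 0 ^ (k - 1) * fps_nth \<phi> J"
proof (induction k)
  case 0
  have "J \<noteq> 0" using J zero_closed by metis
  then show ?case by simp
next
  case (Suc k)
  have "fps_nth (\<phi> ^ Suc k) J = fps_nth \<phi> 0 * fps_nth (\<phi> ^ k) J + fps_nth \<phi> J * fps_nth \<phi> 0 ^ k"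
    using fps_mult_nth_notin[OF \<phi> supp_below_power[OF \<phi>] J, of k] by (simp add: fps_power_zeroth)
  \<comment> \<open>For \<open>k = 0\<close> the truncated exponent \<open>k - 1\<close> is
    harmless, since its factor \<open>of_nat k\<close> vanishes.\<close>
  with Suc show ?case by (cases k) (simp_all add: algebra_simps)
qed

text \<open>In characteristic zero the factor \<open>of_nat k * fps_nth \<phi> 0 ^ (k - 1)\<close>
  is non-zero, so vanishing passes from the power back to \<open>\<phi>\<close>.\<close>

lemma supp_below_of_power:
  fixes \<phi> :: "'a::field_char_0 fps"
  assumes pow: "supp_below K J (\<phi> ^ k)" and "k > 0" "fps_nth \<phi> 0 \<noteq> 0"
  shows "supp_below K J \<phi>"
proof (rule supp_below_induct)
  fix j assume j: "j < J" "j \<notin> K" "supp_below K j \<phi>"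
  have "of_nat k * fps_nth \<phi> 0 ^ (k - 1) * fps_nth \<phi> j = 0"
    using fps_power_nth_notin[OF j(3,2), of k] supp_belowD[OF pow j(1,2)] by simp
  with assms show "fps_nth \<phi> j = 0" by simp
qed

end

section \<open>Coefficients of the dual series and of its powers\<close>

text \<open>Comparison of the coefficients of degree \<open>J + 1\<close> in the composition
  identity. The outer factor \<open>fps_X\<close> turns the exponent \<open>i\<close> into
  \<open>Suc i\<close>, and the inner one shifts the degree to \<open>J - i\<close>.\<close>

lemma dual_fps_nth_sum:
  fixes \<phi> \<psi> :: "'a::field fps"
  assumes "dual_fps \<phi> \<psi>"
  shows "(\<Sum>i\<le>J. fps_nth \<phi> i * fps_nth (\<psi> ^ Suc i) (J - i)) = (if J = 0 then 1 else 0)"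
proof -
  have "fps_nth (fps_X * \<phi> oo fps_X * \<psi>) (Suc J) =
      (\<Sum>i\<le>Suc J. fps_nth (fps_X * \<phi>) i * fps_nth ((fps_X * \<psi>) ^ i) (Suc J))"
    by (simp add: fps_compose_nth atLeast0AtMost)
  also have "\<dots> = (\<Sum>i\<le>J. fps_nth \<phi> i * fps_nth (\<psi> ^ Suc i) (J - i))"
    unfolding sum.atMost_Suc_shift fps_nth_power_X_mult
    by (auto intro!: sum.cong simp del: power_Suc)
  finally have "(\<Sum>i\<le>J. fps_nth \<phi> i * fps_nth (\<psi> ^ Suc i) (J - i)) = fps_nth fps_X (Suc J)"
    using assms by (simp add: dual_fps_def)
  then show ?thesis by (simp add: fps_X_nth)
qed

lemma dual_fps_nth_0:
  fixes \<phi> \<psi> :: "'a::field fps"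
  assumes "dual_fps \<phi> \<psi>"
  shows "fps_nth \<psi> 0 = inverse (fps_nth \<phi> 0)"
  using dual_fps_nth_sum[OF assms, of 0] by (simp add: inverse_unique)

context nat_submonoid
begin

text \<open>The indices \<open>i\<close> and \<open>J - i\<close> add up to \<open>J\<close>, so the
  middle terms vanish as in a product. The two extreme terms give a linear equation for
  \<open>fps_nth \<psi> J\<close>.\<close>

lemma dual_fps_nth_notin:
  fixes \<phi> \<psi> :: "'a::field fps"
  assumes dual: "dual_fps \<phi> \<psi>"
    and \<phi>: "supp_below K J \<phi>" and \<psi>: "supp_below K J \<psi>" and J: "J \<notin> K"
  shows "fps_nth \<psi> J = - fps_nth \<phi> J * inverse (fps_nth \<phi> 0) ^ (J + 2)"
proof -
  let ?f = "\<lambda>i. fps_nth \<phi> i * fps_nth (\<psi> ^ Suc i) (J - i)"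
  have J0: "J \<noteq> 0" using J zero_closed by metis
  have z: "?f i = 0" if "i \<in> {..J} - {0, J}" for i
  proof -
    from that have i: "0 < i" "i < J" by auto
    then have "i \<notin> K \<or> J - i \<notin> K"
      using add_closed[of i "J - i"] J by auto
    with i supp_belowD[OF \<phi>, of i] supp_belowD[OF supp_below_power[OF \<psi>], of "J - i" "Suc i"]
    show ?thesis by (auto simp del: power_Suc)
  qed
  have "0 = (\<Sum>i\<le>J. ?f i)" using dual_fps_nth_sum[OF dual] J0 by simp
  also have "\<dots> = (\<Sum>i\<in>{0, J}. ?f i)"
    using z by (intro sum.mono_neutral_right) auto
  also have "\<dots> = fps_nth \<phi> 0 * fps_nth \<psi> J + fps_nth \<phi> J * inverse (fps_nth \<phi> 0) ^ Suc J"
    using J0 by (simp add: dual_fps_nth_0[OF dual] fps_power_zeroth)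
  finally have "fps_nth \<phi> 0 * fps_nth \<psi> J = - (fps_nth \<phi> J * inverse (fps_nth \<phi> 0) ^ Suc J)"
    by (simp add: eq_neg_iff_add_eq_0)
  moreover have "fps_nth \<phi> 0 \<noteq> 0" using dual by (simp add: dual_fps_def)
  ultimately show ?thesis by (simp add: field_simps)
qed

lemma supp_below_dual:
  fixes \<phi> \<psi> :: "'a::field fps"
  assumes dual: "dual_fps \<phi> \<psi>" and \<phi>: "supp_below K J \<phi>"
  shows "supp_below K J \<psi>"
proof (rule supp_below_induct)
  fix j assume j: "j < J" "j \<notin> K" "supp_below K j \<psi>"
  then have "supp_below K j \<phi>" using \<phi> by (auto intro: supp_below_mono)
  from dual_fps_nth_notin[OF dual this j(3,2)] supp_belowD[OF \<phi> j(1,2)]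
  show "fps_nth \<psi> j = 0" by simp
qed

text \<open>The support condition is carried from \<open>\<phi> ^ m\<close> to
  \<open>\<phi>\<close>, then to the dual \<open>\<psi>\<close>, then to
  \<open>\<psi> ^ n\<close>.\<close>

lemma supp_below_dual_power:
  fixes \<phi> \<psi> :: "'a::field_char_0 fps"
  assumes dual: "dual_fps \<phi> \<psi>" and m: "m > 0" and supp: "supp_below K J (\<phi> ^ m)"
  shows "supp_below K J (\<psi> ^ n)"
proof -
  have "supp_below K J \<phi>"
    using supp_below_of_power[OF supp m] dual by (simp add: dual_fps_def)
  then show ?thesis by (intro supp_below_power supp_below_dual[OF dual])
qed

text \<open>Both coefficients are multiples of \<open>fps_nth \<phi> J\<close>, which is eliminated.
  The exponents of \<open>inverse a\<close> add up as
  \<open>(n - 1) + (J + 2) + (m - 1) = n + m + J\<close>.\<close>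

lemma dual_power_nth_notin:
  fixes \<phi> \<psi> :: "'a::field_char_0 fps"
  assumes dual: "dual_fps \<phi> \<psi>" and m: "m > 0" and n: "n > 0"
    and supp: "supp_below K J (\<phi> ^ m)" and J: "J \<notin> K"
  shows "fps_nth (\<psi> ^ n) J =
    - (of_nat n / of_nat m) * fps_nth \<phi> 0 powi (- int n - int (m + J)) * fps_nth (\<phi> ^ m) J"
proof -
  define a where "a = fps_nth \<phi> 0"
  have a: "a \<noteq> 0" using dual by (simp add: a_def dual_fps_def)
  have \<phi>: "supp_below K J \<phi>"
    using supp_below_of_power[OF supp m] a by (simp add: a_def)
  have \<psi>: "supp_below K J \<psi>" by (rule supp_below_dual[OF dual \<phi>])
  obtain m' n' where mn: "m = Suc m'" "n = Suc n'" using m n by (metis gr0_implies_Suc)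
  have "fps_nth (\<psi> ^ n) J = of_nat n * inverse a ^ n' * (- fps_nth \<phi> J * inverse a ^ (J + 2))"
    unfolding fps_power_nth_notin[OF \<psi> J] dual_fps_nth_0[OF dual]
      dual_fps_nth_notin[OF dual \<phi> \<psi> J] by (simp add: a_def mn)
  moreover have "fps_nth (\<phi> ^ m) J = of_nat m * a ^ m' * fps_nth \<phi> J"
    unfolding fps_power_nth_notin[OF \<phi> J] by (simp add: a_def mn)
  moreover have "a powi (- int n - int (m + J)) = inverse a ^ (n + (m + J))"
  proof -
    have "- int n - int (m + J) = - int (n + (m + J))" by simp
    then show ?thesis by (simp only: power_int_minus power_int_of_nat power_inverse)
  qed
  moreover have "a ^ m' * inverse a ^ m' = 1" using a by (simp flip: power_mult_distrib)
  ultimately show ?thesis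
    using m by (simp add: a_def[symmetric] mn power_add field_simps del: of_nat_Suc)
qed

end

section \<open>Subgroups of the rationals and supports of shifted powers\<close>

lemma nat_submonoid_group_closure: "nat_submonoid {j. of_nat j \<in> group_closure (S :: rat set)}"
  by standard (auto intro: group_closure_add)

lemma group_closure_add_iff:
  assumes "x \<in> group_closure S"
  shows "x + y \<in> group_closure S \<longleftrightarrow> y \<in> group_closure S"
proof
  assume "x + y \<in> group_closure S"
  then have "x + y - x \<in> group_closure S" using assms by (rule group_closure.diff)
  then show "y \<in> group_closure S" by simp
qed (use assms in \<open>auto intro: group_closure_add\<close>)

lemma group_closure_subsetI:
  assumes "S \<subseteq> group_closure T"
  shows "group_closure S \<subseteq> group_closure T"
proof
  fix x assume "x \<in> group_closure S"
  then show "x \<in> group_closure T"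
    using assms by induction (auto intro: group_closure.diff)
qed

lemma group_closure_insert_cong:
  assumes eq: "group_closure S = group_closure T" and xy: "x - y \<in> group_closure S"
  shows "group_closure (insert x S) = group_closure (insert y T)"
proof -
  \<comment> \<open>One inclusion suffices: it is stated for arbitrary data, and exchanging the
    roles gives the other, since \<open>y - x\<close> lies in the group as well.\<close>
  have "group_closure (insert x S) \<subseteq> group_closure (insert y T)"
    if eq: "group_closure S = group_closure T" and xy: "x - y \<in> group_closure S"
    for S T :: "'a set" and x y
  proof (rule group_closure_subsetI)
    have T: "group_closure T \<subseteq> group_closure (insert y T)"
      by (rule group_closure_subsetI) (auto intro: group_closure.base)
    have "x - y + y \<in> group_closure (insert y T)"
      using xy eq T by (intro group_closure_add) (auto intro: group_closure.base)
    moreover have "S \<subseteq> group_closure S" by (auto intro: group_closure.base)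
    ultimately show "insert x S \<subseteq> group_closure (insert y T)" using eq T by auto
  qed
  from this[OF eq xy] this[OF eq[symmetric], of y x] group_closure_minus_iff[of "x - y" S] xy
  show ?thesis using eq by auto
qed

lemma fps_supp_power_X_mult:
  fixes \<phi> :: "'a::comm_ring_1 fps"
  shows "fps_supp ((fps_X * \<phi>) ^ k) = {of_nat (k + j) | j. fps_nth (\<phi> ^ k) j \<noteq> 0}"
proof -
  have "fps_nth ((fps_X * \<phi>) ^ k) r \<noteq> 0 \<longleftrightarrow> (\<exists>j. r = k + j \<and> fps_nth (\<phi> ^ k) j \<noteq> 0)" for r
    unfolding fps_nth_power_X_mult by (cases "r < k") (auto intro!: exI[of _ "r - k"])
  then show ?thesis unfolding fps_supp_def by (simp only:) blast
qed

lemma fps_supp_power_X_mult_subset_iff: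
  fixes \<phi> :: "'a::comm_ring_1 fps"
  assumes "of_nat k \<in> group_closure S"
  shows "fps_supp ((fps_X * \<phi>) ^ k) \<subseteq> group_closure S \<longleftrightarrow>
    (\<forall>j. fps_nth (\<phi> ^ k) j \<noteq> 0 \<longrightarrow> of_nat j \<in> group_closure S)"
  using group_closure_add_iff[OF assms] by (auto simp: fps_supp_power_X_mult)

text \<open>Translation by \<open>k\<close> preserves the order and, as \<open>k\<close> lies in the
  group, also membership in the group. The first exponent \<open>J\<close> of
  \<open>\<phi> ^ k\<close> outside the group is therefore translated to the minimum.\<close>

lemma Least_fps_supp_power_X_mult:
  fixes \<phi> :: "'a::comm_ring_1 fps"
  assumes k: "of_nat k \<in> group_closure S"
    and supp: "supp_below {j. of_nat j \<in> group_closure S} J (\<phi> ^ k)"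
    and J: "of_nat J \<notin> group_closure S" "fps_nth (\<phi> ^ k) J \<noteq> 0"
  shows "(LEAST e. e \<in> fps_supp ((fps_X * \<phi>) ^ k) - group_closure S) = of_nat (k + J)"
proof (rule Least_equality)
  show "of_nat (k + J) \<in> fps_supp ((fps_X * \<phi>) ^ k) - group_closure S"
    using J group_closure_add_iff[OF k] by (auto simp: fps_supp_power_X_mult)
next
  fix e assume "e \<in> fps_supp ((fps_X * \<phi>) ^ k) - group_closure S"
  then obtain j where "e = of_nat (k + j)" "fps_nth (\<phi> ^ k) j \<noteq> 0" "of_nat j \<notin> group_closure S"
    using group_closure_add_iff[OF k] by (auto simp: fps_supp_power_X_mult)
  with supp_belowD[OF supp, of j] show "of_nat (k + J) \<le> e" by force
qed

section \<open>The two essential sequences, entry by entry\<close>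

lemma ess_power_X_mult_0:
  fixes \<phi> :: "'a::field fps"
  assumes "fps_nth \<phi> 0 \<noteq> 0"
  shows "ess_fps ((fps_X * \<phi>) ^ k) p 0 = Some (of_nat k)"
proof -
  have "(LEAST e. e \<in> fps_supp ((fps_X * \<phi>) ^ k)) = of_nat k"
    unfolding fps_supp_power_X_mult
    by (rule Least_equality) (auto simp: fps_power_zeroth assms intro!: exI[of _ 0])
  then show ?thesis by (simp add: ess_fps_def)
qed

text \<open>Generators of the group that decides about the entry \<open>Suc l\<close>; undefined
  entries contribute nothing.\<close>

definition ess_gens :: "'a::zero fps \<Rightarrow> nat \<Rightarrow> nat \<Rightarrow> rat set" where
  "ess_gens \<phi> p l = insert (of_nat p) (\<Union>j\<in>{..l}. set_option (ess_fps \<phi> p j))"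

lemma ess_fps_Suc:
  "ess_fps \<phi> p (Suc l) =
     (if fps_supp \<phi> \<subseteq> group_closure (ess_gens \<phi> p l) then None
      else Some (LEAST e. e \<in> fps_supp \<phi> - group_closure (ess_gens \<phi> p l)))"
  by (simp add: ess_fps_def ess_gens_def Let_def)

lemma ess_gens_Suc: "ess_gens \<phi> p (Suc l) = set_option (ess_fps \<phi> p (Suc l)) \<union> ess_gens \<phi> p l"
  by (auto simp: ess_gens_def atMost_Suc)

text \<open>Once the two groups agree, their natural elements form a single monoid \<open>K\<close>,
  and \<open>\<phi> ^ m\<close> and \<open>\<psi> ^ n\<close> have the same first exponent
  \<open>J\<close> outside \<open>K\<close>, or both have none. The factors \<open>fps_X ^ m\<close>
  and \<open>fps_X ^ n\<close> shift it differently.\<close>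

lemma dual_ess_step:
  fixes \<phi> \<psi> :: "'a::field_char_0 fps"
  defines "\<eta> \<equiv> \<lambda>m. (fps_X * \<phi>) ^ m" and "\<xi> \<equiv> \<lambda>n. (fps_X * \<psi>) ^ n"
  assumes dual: "dual_fps \<phi> \<psi>" and m: "m > 0" and n: "n > 0"
    and eq: "group_closure (ess_gens (\<eta> m) n l) = group_closure (ess_gens (\<xi> n) m l)"
  obtains (none) "ess_fps (\<eta> m) n (Suc l) = None" "ess_fps (\<xi> n) m (Suc l) = None"
  | (some) J where "ess_fps (\<eta> m) n (Suc l) = Some (of_nat (m + J))"
      "ess_fps (\<xi> n) m (Suc l) = Some (of_nat (n + J))"
      "fps_nth (\<xi> n) (n + J) = - (of_nat n / of_nat m) *
         fps_nth \<phi> 0 powi (- int n - int (m + J)) * fps_nth (\<eta> m) (m + J)"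
proof -
  let ?S = "ess_gens (\<eta> m) n l"
  define K where "K = {j. of_nat j \<in> group_closure ?S}"
  interpret nat_submonoid K unfolding K_def by (rule nat_submonoid_group_closure)
  have nS: "of_nat n \<in> group_closure ?S"
    by (auto simp: ess_gens_def intro: group_closure.base)
  \<comment> \<open>On the side of \<open>\<xi>\<close> the modulus is \<open>m\<close>, so
    \<open>m\<close> belongs to the common group.\<close>
  have mS: "of_nat m \<in> group_closure ?S"
    unfolding eq by (auto simp: ess_gens_def intro: group_closure.base)
  show ?thesis
  proof (cases "\<forall>j. fps_nth (\<phi> ^ m) j \<noteq> 0 \<longrightarrow> j \<in> K")
    case True
    then have "supp_below K J (\<phi> ^ m)" for J by (auto simp: supp_below_def)
    then have "supp_below K J (\<psi> ^ n)" for J by (rule supp_below_dual_power[OF dual m])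
    then have "\<forall>j. fps_nth (\<psi> ^ n) j \<noteq> 0 \<longrightarrow> j \<in> K" by (auto simp: supp_below_def)
    then have "fps_supp (\<xi> n) \<subseteq> group_closure ?S"
      by (simp add: fps_supp_power_X_mult_subset_iff[OF nS] K_def \<xi>_def)
    moreover have "fps_supp (\<eta> m) \<subseteq> group_closure ?S"
      using True fps_supp_power_X_mult_subset_iff[OF mS, of \<phi>] by (simp add: K_def \<eta>_def)
    ultimately show thesis by (intro none) (simp_all add: ess_fps_Suc eq)
  next
    case False
    define J where "J = (LEAST j. fps_nth (\<phi> ^ m) j \<noteq> 0 \<and> j \<notin> K)"
    have J: "fps_nth (\<phi> ^ m) J \<noteq> 0" "J \<notin> K"
      using LeastI_ex[of "\<lambda>j. fps_nth (\<phi> ^ m) j \<noteq> 0 \<and> j \<notin> K"] False by (auto simp: J_def)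
    have supp: "supp_below K J (\<phi> ^ m)"
      unfolding supp_below_def J_def by (auto dest: not_less_Least)
    have supp': "supp_below K J (\<psi> ^ n)" by (rule supp_below_dual_power[OF dual m supp])
    note coeff = dual_power_nth_notin[OF dual m n supp J(2)]
    \<comment> \<open>The scalar factor in \<open>coeff\<close> is non-zero, so \<open>J\<close>
      really occurs in \<open>\<psi> ^ n\<close>; by \<open>supp'\<close> no smaller exponent
      outside \<open>K\<close> does.\<close>
    have J': "fps_nth (\<psi> ^ n) J \<noteq> 0"
      using dual m n J(1) by (auto simp: coeff dual_fps_def)
    note JS = J(2)[unfolded K_def mem_Collect_eq]
    have "\<not> fps_supp (\<eta> m) \<subseteq> group_closure ?S"
      using J(1) JS fps_supp_power_X_mult_subset_iff[OF mS, of \<phi>] by (auto simp: \<eta>_def)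
    moreover have "(LEAST e. e \<in> fps_supp (\<eta> m) - group_closure ?S) = of_nat (m + J)"
      unfolding \<eta>_def
      by (rule Least_fps_supp_power_X_mult) (use mS supp J JS in \<open>simp_all add: K_def \<eta>_def\<close>)
    ultimately have ess_\<eta>: "ess_fps (\<eta> m) n (Suc l) = Some (of_nat (m + J))"
      by (simp only: ess_fps_Suc if_False)
    have "\<not> fps_supp (\<xi> n) \<subseteq> group_closure ?S"
      using J' JS fps_supp_power_X_mult_subset_iff[OF nS, of \<psi>] by (auto simp: \<xi>_def)
    moreover have "(LEAST e. e \<in> fps_supp (\<xi> n) - group_closure ?S) = of_nat (n + J)"
      unfolding \<xi>_def
      by (rule Least_fps_supp_power_X_mult) (use nS supp' J' JS in \<open>simp_all add: K_def \<eta>_def \<xi>_def\<close>)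
    ultimately have ess_\<xi>: "ess_fps (\<xi> n) m (Suc l) = Some (of_nat (n + J))"
      by (simp only: ess_fps_Suc if_False flip: eq)
    from ess_\<eta> ess_\<xi> show thesis
      by (rule some) (simp add: \<eta>_def \<xi>_def fps_nth_power_X_mult coeff)
  qed
qed

text \<open>Both groups start from the generators \<open>m\<close> and \<open>n\<close>. The
  elements \<open>m + J\<close> and \<open>n + J\<close> adjoined later differ by
  \<open>m - n\<close>, which already lies in the common group.\<close>

lemma dual_ess_group_closure_eq:
  fixes \<phi> \<psi> :: "'a::field_char_0 fps"
  assumes dual: "dual_fps \<phi> \<psi>" and m: "m > 0" and n: "n > 0"
  shows "group_closure (ess_gens ((fps_X * \<phi>) ^ m) n l) =
    group_closure (ess_gens ((fps_X * \<psi>) ^ n) m l)"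
proof (induction l)
  case 0
  have "fps_nth \<phi> 0 \<noteq> 0" "fps_nth \<psi> 0 \<noteq> 0" using dual by (auto simp: dual_fps_def)
  then show ?case by (simp add: ess_gens_def ess_power_X_mult_0 insert_commute)
next
  case (Suc l)
  show ?case
  proof (cases rule: dual_ess_step[OF dual m n Suc, case_names none some])
    case none
    then show ?thesis using Suc by (simp add: ess_gens_Suc)
  next
    case (some J)
    let ?G = "group_closure (ess_gens ((fps_X * \<phi>) ^ m) n l)"
    have "of_nat n \<in> ?G"
      by (auto simp: ess_gens_def intro: group_closure.base)
    moreover have "of_nat m \<in> ?G"
      unfolding Suc by (auto simp: ess_gens_def intro: group_closure.base)
    ultimately have "of_nat m - of_nat n \<in> ?G" by (intro group_closure.diff)
    then have "of_nat (m + J) - of_nat (n + J) \<in> ?G" by simp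
    from group_closure_insert_cong[OF Suc this] some(1,2) show ?thesis
      by (simp add: ess_gens_Suc)
  qed
qed

theorem theorem4p4:
  fixes \<eta>0 \<xi>0 \<eta> \<xi> :: "'a::{alg_closed_field, field_char_0} fps"
    and a :: 'a
    and m n d d' :: nat
    and \<epsilon> \<epsilon>' :: "nat \<Rightarrow> nat"
  assumes "fps_nth \<eta>0 0 \<noteq> 0" and "fps_nth \<xi>0 0 \<noteq> 0"
    and "dual_fps \<eta>0 \<xi>0"
    and "m > 0" and "n > 0"
    and "a = fps_nth \<eta>0 0"
    and "\<eta> = (fps_X * \<eta>0) ^ m"
    and "\<xi> = (fps_X * \<xi>0) ^ n"
    and "ess_fps \<eta> n = finite_seq d (\<lambda>k. of_nat (\<epsilon> k))"
    and "ess_fps \<xi> m = finite_seq d' (\<lambda>k. of_nat (\<epsilon>' k))"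
  shows "\<epsilon> 0 = m \<and> \<epsilon>' 0 = n \<and>
    d' = d \<and>
    (\<forall>k\<in>{1..d}. \<epsilon>' k + m = \<epsilon> k + n) \<and>
    fps_nth \<xi> n = a powi (- int n) \<and>
    (\<forall>k\<in>{1..d}. fps_nth \<xi> (\<epsilon>' k) =
       - (of_nat n / of_nat m) * a powi (- int n - int (\<epsilon> k)) * fps_nth \<eta> (\<epsilon> k))"
proof -
  note dual = \<open>dual_fps \<eta>0 \<xi>0\<close> and m = \<open>m > 0\<close> and n = \<open>n > 0\<close>
  note \<eta> = \<open>\<eta> = (fps_X * \<eta>0) ^ m\<close> and \<xi> = \<open>\<xi> = (fps_X * \<xi>0) ^ n\<close>
  note ess_\<eta> = \<open>ess_fps \<eta> n = finite_seq d (\<lambda>k. of_nat (\<epsilon> k))\<close>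
    and ess_\<xi> = \<open>ess_fps \<xi> m = finite_seq d' (\<lambda>k. of_nat (\<epsilon>' k))\<close>
  have zero: "\<epsilon> 0 = m" "\<epsilon>' 0 = n"
    using ess_power_X_mult_0[OF assms(1), of m n] ess_power_X_mult_0[OF assms(2), of n m] ess_\<eta> ess_\<xi>
    by (simp_all add: \<eta> \<xi> finite_seq_def)
  \<comment> \<open>Definedness is compared index by index together with the two formulas, because
    \<open>d' = d\<close> is not yet known.\<close>
  have step: "(k \<le> d \<longleftrightarrow> k \<le> d') \<and> (k \<le> d \<longrightarrow> \<epsilon>' k + m = \<epsilon> k + n \<and>
      fps_nth \<xi> (\<epsilon>' k) =
        - (of_nat n / of_nat m) * a powi (- int n - int (\<epsilon> k)) * fps_nth \<eta> (\<epsilon> k))"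
    if k: "k > 0" for k
  proof -
    obtain l where l: "k = Suc l" using k by (metis gr0_implies_Suc)
    show ?thesis
    proof (cases rule: dual_ess_step[OF dual m n dual_ess_group_closure_eq[OF dual m n, of l],
          case_names none some])
      case none
      then show ?thesis using ess_\<eta> ess_\<xi>
        by (simp add: l \<eta> \<xi> finite_seq_def split: if_splits)
    next
      case (some J)
      have "k \<le> d" "of_nat (\<epsilon> k) = (of_nat (m + J) :: rat)"
        using some(1) ess_\<eta> by (simp_all only: l \<eta> finite_seq_def split: if_splits) auto
      moreover have "k \<le> d'" "of_nat (\<epsilon>' k) = (of_nat (n + J) :: rat)"
        using some(2) ess_\<xi> by (simp_all only: l \<xi> finite_seq_def split: if_splits) auto
      moreover note some(3)[folded \<eta> \<xi> \<open>a = fps_nth \<eta>0 0\<close>]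
      ultimately show ?thesis by (simp only: of_nat_eq_iff) simp
    qed
  qed
  \<comment> \<open>Each inequality is \<open>step\<close> at the last index of one sequence; index
    \<open>0\<close> is trivial.\<close>
  have "d' = d"
  proof (rule antisym)
    show "d' \<le> d" using step[of d'] by (cases "d' = 0") auto
    show "d \<le> d'" using step[of d] by (cases "d = 0") auto
  qed
  moreover have "fps_nth \<xi> n = a powi (- int n)"
    by (simp add: \<xi> fps_nth_power_X_mult fps_power_zeroth dual_fps_nth_0[OF dual]
        \<open>a = fps_nth \<eta>0 0\<close> power_int_minus power_inverse)
  ultimately show ?thesis using zero step by auto
qed

end
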